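(* For $\beta\in\mathbb{R}$ let $Q_\beta(X)=X^3+(1-\beta)X^2-(2+\beta)X-1$. Let $\beta,\gamma\in\mathbb{R}$. (i) All roots of $Q_\beta$ are real, and, denoting them in increasing order by $q^{\langle\beta\rangle}_1,q^{\langle\beta\rangle}_2,q^{\langle\beta\rangle}_3$, they satisfy $q^{\langle\beta\rangle}_1<-1<q^{\langle\beta\rangle}_2<0<q^{\langle\beta\rangle}_3$. (ii) If $q$ is a root of $Q_\beta$, then the other two roots are $-\frac1q-1$ and $-\frac{1}{q+1}$. (iii) If $\beta<\gamma$, then $q^{\langle\beta\rangle}_1<q^{\langle\gamma\rangle}_1<-1<q^{\langle\beta\rangle}_2<q^{\langle\gamma\rangle}_2<0<q^{\langle\beta\rangle}_3<q^{\langle\gamma\rangle}_3$. *)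

theory Defs
  imports Complex_Main "HOL-Computational_Algebra.Polynomial" "HOL-Library.Multiset"
begin

definition Q :: "real \<Rightarrow> real poly" where
  "Q \<beta> = monom 1 3 + monom (1 - \<beta>) 2 - monom (2 + \<beta>) 1 - 1"

abbreviation Q_complex :: "real \<Rightarrow> complex poly" where
  "Q_complex \<beta> \<equiv> map_poly complex_of_real (Q \<beta>)"

text \<open>The \<open>i\<close>-th smallest real root of \<open>Q \<beta>\<close>, for \<open>i = 1, 2, 3\<close>, counted with multiplicity.
  It is meaningful only if \<open>Q \<beta>\<close> has at least \<open>i\<close> real roots with multiplicity; nothing in the
  definition presupposes that there are three.\<close>

definition q_root :: "real \<Rightarrow> nat \<Rightarrow> real" where
  "q_root \<beta> i = sorted_list_of_multiset (proots (Q \<beta>)) ! (i - 1)"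

end

theory Submission
  imports Defs
begin

text \<open>Solving \<open>Q_b(q) = 0\<close> for \<open>b\<close> as \<open>b = q - 1/q - 1/(q + 1)\<close> shows that the roots of \<open>Q_b\<close>
  are permuted by \<open>q \<mapsto> -1/q - 1\<close>, so one root determines the factorisation. Start from a positive
  root \<open>c\<close>, which exists since \<open>Q_b(0) < 0\<close>: the roots \<open>-1/c - 1 < -1 < -1/(c + 1) < 0 < c\<close>
  are increasing functions of \<open>c\<close>, and \<open>c\<close> increases with \<open>b\<close>.\<close>

lemma Q_eq: "Q b = [:-1, -(2 + b), 1 - b, 1:]"
  unfolding Q_def by (rule poly_eqI) (auto simp: coeff_pCons split: nat.splits)

lemma Q_complex_eq:
  "Q_complex b = [:-1, -(2 + of_real b), 1 - of_real b, 1:]"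
  by (simp add: Q_eq map_poly_pCons)

lemma cubic_root_nonzero:
  fixes b q :: "'a::field"
  assumes "poly [:-1, -(2 + b), 1 - b, 1:] q = 0"
  shows "q \<noteq> 0" "q + 1 \<noteq> 0"
proof -
  show "q \<noteq> 0"
    using assms by auto
  show "q + 1 \<noteq> 0"
  proof
    assume "q + 1 = 0"
    then have "q = -1"
      by (simp add: eq_neg_iff_add_eq_0)
    then show False
      using assms by (simp add: algebra_simps)
  qed
qed

lemma cubic_parameter_eq:
  fixes b q :: "'a::field"
  assumes "poly [:-1, -(2 + b), 1 - b, 1:] q = 0"
  shows "b = q - 1 / q - 1 / (q + 1)"
proof -
  have "q * q + q * (q * q) = 1 + (b * (q * (q + 1)) + q * 2)"
    using assms by (simp add: algebra_simps)
  moreover define u v where "u = 1 / q" and "v = 1 / (q + 1)"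
  moreover have "q * u = 1" "(q + 1) * v = 1"
    using cubic_root_nonzero[OF assms] by (simp_all add: u_def v_def)
  ultimately have "b = q - u - v"
    by algebra
  then show ?thesis
    by (simp add: u_def v_def)
qed

lemma cubic_factorisation:
  fixes b q :: "'a::field"
  assumes "poly [:-1, -(2 + b), 1 - b, 1:] q = 0"
  shows "[:-1, -(2 + b), 1 - b, 1:] = [:-q, 1:] * [:-(- (1 / q) - 1), 1:] * [:-(- (1 / (q + 1))), 1:]"
proof -
  define u v where "u = 1 / q" and "v = 1 / (q + 1)"
  have "q * u = 1" "(q + 1) * v = 1"
    using cubic_root_nonzero[OF assms] by (simp_all add: u_def v_def)
  moreover have "b = q - u - v"
    using cubic_parameter_eq[OF assms] by (simp add: u_def v_def)
  ultimately have "-1 = - q * (u + 1) * v" "-(2 + b) = - q * (u + 1 + v) + (u + 1) * v"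
    "1 - b = - q + (u + 1) + v"
    by algebra+
  then show ?thesis
    unfolding u_def[symmetric] v_def[symmetric] by (simp add: algebra_simps)
qed

lemma proots_cubic:
  fixes b q :: "'a::field"
  assumes "poly [:-1, -(2 + b), 1 - b, 1:] q = 0"
  shows "proots [:-1, -(2 + b), 1 - b, 1:] = {#q, - (1 / q) - 1, - (1 / (q + 1))#}"
proof -
  have "proots ([:-x, 1:] * [:-y, 1:] * [:-z, 1:]) = {#x, y, z#}" for x y z :: 'a
    using proots_linear_factor[of x] proots_linear_factor[of y] proots_linear_factor[of z]
    by (simp add: proots_mult add_mset_commute del: mult_pCons_left mult_pCons_right)
  then show ?thesis
    unfolding cubic_factorisation[OF assms] .
qed

lemma Q_positive_root: obtains c where "c > 0" "poly (Q b) c = 0"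
proof -
  define x where "x = 2 + \<bar>b\<bar>"
  have "0 \<le> x * (x + 1) * (x - b - 2)" "x \<ge> 2"
    by (auto simp: x_def)
  then have "0 < x * (x + 1) * (x - b - 2) + 2 * (x * x) - 1"
    using mult_mono[of 2 x 2 x] by simp
  also have "\<dots> = poly (Q b) x"
    by (simp add: Q_eq algebra_simps)
  finally have "poly (Q b) x > 0" .
  moreover have "poly (Q b) 0 < 0"
    by (simp add: Q_eq)
  ultimately show thesis
    using poly_IVT_pos[of 0 x "Q b"] \<open>x \<ge> 2\<close> that by auto
qed

lemma q_roots:
  assumes "c > 0" "poly (Q b) c = 0"
  shows "q_root b 1 = - (1 / c) - 1" "q_root b 2 = - (1 / (c + 1))" "q_root b 3 = c"
proof -
  have less: "- (1 / c) - 1 < - (1 / (c + 1))" "- (1 / (c + 1)) < c"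
    using assms(1) by (simp_all add: field_simps add_pos_pos less_trans[of "-1" 0])
  have "proots (Q b) = mset [- (1 / c) - 1, - (1 / (c + 1)), c]"
    using proots_cubic[of b c] assms by (simp add: Q_eq add_mset_commute)
  moreover have "sort [- (1 / c) - 1, - (1 / (c + 1)), c] = [- (1 / c) - 1, - (1 / (c + 1)), c]"
    using less by (intro sort_key_id_if_sorted) auto
  ultimately have "sorted_list_of_multiset (proots (Q b)) = [- (1 / c) - 1, - (1 / (c + 1)), c]"
    by (simp only: sorted_list_of_multiset_mset)
  then show "q_root b 1 = - (1 / c) - 1" "q_root b 2 = - (1 / (c + 1))" "q_root b 3 = c"
    by (simp_all add: q_root_def)
qed

lemma positive_root_strict_mono:
  assumes "c > 0" "poly (Q b) c = 0" "d > 0" "poly (Q b') d = 0" "b < b'"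
  shows "c < d"
proof (rule ccontr)
  assume "\<not> c < d"
  then have "1 / c \<le> 1 / d" "1 / (c + 1) \<le> 1 / (d + 1)"
    using assms by (simp_all add: frac_le)
  moreover have "b = c - 1 / c - 1 / (c + 1)" "b' = d - 1 / d - 1 / (d + 1)"
    using cubic_parameter_eq assms by (simp_all only: Q_eq)
  ultimately show False
    using \<open>b < b'\<close> \<open>\<not> c < d\<close> by linarith
qed

theorem lemmaA1:
  fixes \<beta> \<gamma> :: real
  shows "((\<forall>z. poly (Q_complex \<beta>) z = 0 \<longrightarrow> z \<in> \<real>) \<and>
          proots (Q_complex \<beta>) =
            {#complex_of_real (q_root \<beta> 1), complex_of_real (q_root \<beta> 2), complex_of_real (q_root \<beta> 3)#} \<and>
          q_root \<beta> 1 < -1 \<and> -1 < q_root \<beta> 2 \<and> q_root \<beta> 2 < 0 \<and> 0 < q_root \<beta> 3)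
       \<and> (\<forall>q. poly (Q_complex \<beta>) q = 0 \<longrightarrow>
            q \<noteq> 0 \<and> q + 1 \<noteq> 0 \<and>
            proots (Q_complex \<beta>) = {#q, - (1 / q) - 1, - (1 / (q + 1))#})
       \<and> (\<beta> < \<gamma> \<longrightarrow>
            q_root \<beta> 1 < q_root \<gamma> 1 \<and> q_root \<gamma> 1 < -1 \<and>
            -1 < q_root \<beta> 2 \<and> q_root \<beta> 2 < q_root \<gamma> 2 \<and> q_root \<gamma> 2 < 0 \<and>
            0 < q_root \<beta> 3 \<and> q_root \<beta> 3 < q_root \<gamma> 3)"
proof -
  obtain c where c: "c > 0" "poly (Q \<beta>) c = 0"
    by (rule Q_positive_root)
  obtain d where d: "d > 0" "poly (Q \<gamma>) d = 0"
    by (rule Q_positive_root)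
  have bounds: "- (1 / x) - 1 < -1" "-1 < - (1 / (x + 1))" "- (1 / (x + 1)) < 0"
    if "x > 0" for x :: real
    using that by (simp_all add: field_simps)
  have "poly (Q_complex \<beta>) (of_real c) = of_real (poly (Q \<beta>) c)"
    unfolding Q_complex_eq by (simp add: Q_eq)
  then have "poly (Q_complex \<beta>) (of_real c) = 0"
    using c by simp
  then have roots: "proots (Q_complex \<beta>) =
      {#complex_of_real c, complex_of_real (- (1 / c) - 1), complex_of_real (- (1 / (c + 1)))#}"
    unfolding Q_complex_eq by (subst proots_cubic) simp_all
  have "Q_complex \<beta> \<noteq> 0"
    by (simp add: Q_complex_eq)
  have real: "z \<in> \<real>" if "poly (Q_complex \<beta>) z = 0" for z
  proof -
    have "z \<in># proots (Q_complex \<beta>)"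
      using that \<open>Q_complex \<beta> \<noteq> 0\<close> by simp
    then show ?thesis
      unfolding roots by (auto simp del: of_real_minus of_real_diff)
  qed
  have ii: "q \<noteq> 0 \<and> q + 1 \<noteq> 0 \<and> proots (Q_complex \<beta>) = {#q, - (1 / q) - 1, - (1 / (q + 1))#}"
    if "poly (Q_complex \<beta>) q = 0" for q
    using that cubic_root_nonzero proots_cubic unfolding Q_complex_eq by blast
  have "c < d \<and> 1 / d < 1 / c \<and> 1 / (d + 1) < 1 / (c + 1)" if "\<beta> < \<gamma>"
    using positive_root_strict_mono[OF c d that] c d by (simp add: frac_less2)
  then show ?thesis
    using real ii bounds[OF c(1)] bounds[OF d(1)] c(1) d(1)
    unfolding q_roots[OF c] q_roots[OF d] roots by (auto simp: add_mset_commute)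
qed

end
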